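(* Let $n\ge 2$ and let $S$ be a skew-symmetric subset of $\mathbb{Z}_n$. Then the oriented circulant graph $\mathrm{Circ}(\mathbb{Z}_n,S)$ is HS-integral if and only if $$S=\begin{cases}\emptyset & \text{if } n\not\equiv 0\pmod 3,\\ \bigcup_{d\in\mathscr{D}}S_n(d) & \text{if } n\equiv 0\pmod 3,\end{cases}$$ for some $\mathscr{D}\subseteq\{d: d\mid\frac n3\}$ and some choice of $S_n(d)\in\{G_{n,3}^1(d),G_{n,3}^2(d)\}$ for each $d\in\mathscr{D}$.
   Context: Elements of $\mathbb{Z}_n$ are identified with $0,1,\dots,n-1$. A subset $S\subseteq\mathbb{Z}_n$ with $0\notin S$ is skew-symmetric if $-a\notin S$ for all $a\in S$. The graph $\mathrm{Circ}(\mathbb{Z}_n,S)$ has vertex set $\mathbb{Z}_n$ and directed edge set $\{(a,b): b-a\in S\}$. Its Hermitian-adjacency matrix of the second kind is $\mathcal{H}=(h_{uv})$ with $h_{uv}=1$ if both $(u,v)$ and $(v,u)$ are edges, $h_{uv}=\frac{1+i\sqrt3}{2}$ if only $(u,v)$ is an edge, $h_{uv}=\frac{1-i\sqrt3}{2}$ if only $(v,u)$ is an edge, and $h_{uv}=0$ otherwise. The graph is HS-integral if all eigenvalues of $\mathcal{H}$ are integers. For $n\equiv 0\pmod 3$, a positive divisor $d$ of $\frac n3$ and $r\in\{1,2\}$, $G_{n,3}^r(d)=\{dk: 1\le dk\le n-1,\ \gcd(dk,n)=d,\ k\equiv r\pmod 3\}$. *)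

theory Defs
  imports
    "Jordan_Normal_Form.Char_Poly"
    "Graph_Theory.Pair_Digraph"
    "HOL-Number_Theory.Cong"
begin

text \<open>The elements of \<open>\<int>\<^sub>n\<close> are the natural numbers \<open>0, \<dots>, n - 1\<close>; negation and
  subtraction modulo \<open>n\<close> go through \<open>int\<close> because subtraction on \<open>nat\<close> truncates.\<close>

definition skew_symmetric :: "nat \<Rightarrow> nat set \<Rightarrow> bool" where
  "skew_symmetric n S \<longleftrightarrow>
     S \<subseteq> {0..<n} \<and> 0 \<notin> S \<and> (\<forall>a\<in>S. nat ((- int a) mod int n) \<notin> S)"

definition Circ :: "nat \<Rightarrow> nat set \<Rightarrow> nat pair_pre_digraph" where
  "Circ n S =
     \<lparr> pverts = {0..<n},
       parcs = {(a, b). a < n \<and> b < n \<and> nat ((int b - int a) mod int n) \<in> S} \<rparr>"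

text \<open>The Hermitian-adjacency matrix of the second kind, for a graph whose vertex set is
  \<open>{0..<m}\<close> for some \<open>m\<close>, so that vertices serve directly as row and column indices.\<close>

definition hermitian_adjacency2 :: "nat pair_pre_digraph \<Rightarrow> complex mat" where
  "hermitian_adjacency2 G =
     mat (card (pverts G)) (card (pverts G))
       (\<lambda>(u, v).
          if (u, v) \<in> parcs G \<and> (v, u) \<in> parcs G then 1
          else if (u, v) \<in> parcs G then (1 + \<i> * complex_of_real (sqrt 3)) / 2
          else if (v, u) \<in> parcs G then (1 - \<i> * complex_of_real (sqrt 3)) / 2
          else 0)"

definition HS_integral :: "nat pair_pre_digraph \<Rightarrow> bool" where
  "HS_integral G \<longleftrightarrow> (\<forall>x. eigenvalue (hermitian_adjacency2 G) x \<longrightarrow> x \<in> \<int>)"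

text \<open>\<open>G3 n r d\<close> is the set \<open>G\<^sub>n\<^sub>,\<^sub>3\<^sup>r(d)\<close>, meant for \<open>3 dvd n\<close>, \<open>d dvd n div 3\<close> and \<open>r \<in> {1, 2}\<close>.\<close>

definition G3 :: "nat \<Rightarrow> nat \<Rightarrow> nat \<Rightarrow> nat set" where
  "G3 n r d = {d * k | k. 1 \<le> d * k \<and> d * k \<le> n - 1 \<and> gcd (d * k) n = d \<and> [k = r] (mod 3)}"

end

theory Submission
  imports Defs
begin

text \<open>
  The matrix of the graph is circulant, so its eigenvalues are the Fourier coefficients
  \<open>\<gamma>\<^sub>j = \<Sum>\<^sub>k h(k) \<zeta>\<^bsup>j k\<^esup>\<close>, where \<open>\<zeta> = exp (2 \<pi> \<i> / n)\<close> and the connection function \<open>h\<close>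
  is \<open>\<epsilon> = (1 + \<i> \<surd>3) / 2\<close> on \<open>S\<close>, the conjugate of \<open>\<epsilon>\<close> on \<open>- S\<close>, and \<open>0\<close>
  elsewhere (\<open>eigenvalue_circulant\<close>, \<open>HS_integral_Circ_iff\<close>).

  Suppose that all \<open>\<gamma>\<^sub>j\<close> are integers. Galois theory of cyclotomic fields would give
  \<open>\<gamma>\<^bsub>a j\<^esub> = \<gamma>\<^sub>j\<close> for every unit \<open>a\<close> modulo \<open>n\<close> with \<open>a \<equiv> 1 (mod 3)\<close>; an elementary
  argument suffices here. For a prime \<open>p\<close>, raising \<open>\<gamma>\<^sub>j\<close> to the \<open>p\<close>-th power term by term shows
  that \<open>\<gamma>\<^bsub>\<plusminus> p j\<^esub> \<equiv> \<gamma>\<^sub>j (mod p)\<close>, where the sign is that of \<open>p\<close> modulo 3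
  (\<open>cong_power_sum_roots_of_unity\<close>). As \<open>\<bar>\<gamma>\<^sub>j\<bar> \<le> n\<close>, the congruence is an equality once \<open>p > 2 n\<close>,
  and it extends to all products of such primes. By the Chinese remainder theorem every unit is
  represented by such a product (\<open>ex_cong_coprime\<close>), so Dirichlet's theorem on primes is avoided.
  Fourier inversion then gives \<open>h(a k) = h(k)\<close> (\<open>dilation_invariant\<close>).

  Let \<open>k \<in> S\<close> and \<open>d = gcd(k, n)\<close>. If 3 did not divide \<open>n / d\<close>, a multiplier \<open>a\<close> as above could
  be chosen with \<open>a \<equiv> -1 (mod n / d)\<close>, which puts \<open>-k\<close> into \<open>S\<close>, against skew-symmetry. So \<open>d\<close>
  divides \<open>n / 3\<close>; in particular \<open>S\<close> is empty unless 3 divides \<open>n\<close>. The multipliers act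
  transitively on the elements \<open>d u\<close> of the gcd class of \<open>d\<close> with a given residue of \<open>u\<close>
  modulo 3, and negation exchanges the two residues, so \<open>S\<close> meets this class in exactly
  one of its two halves (\<open>HS_integral_gcd_class\<close>).

  Conversely, if \<open>S\<close> is a union of such halves, then on each gcd class \<open>h\<close> is zero or the negative
  of a character, because \<open>\<epsilon> = - exp (- 2 \<pi> \<i> / 3)\<close> (\<open>circ_weight_union_G3\<close>). Hence
  \<open>\<gamma>\<^sub>j\<close> is a sum of negated Ramanujan sums, which are integers (\<open>ramanujan_sum_Ints\<close>).
\<close>

section \<open>Characters of the cyclic group\<close>

definition unity_root :: "nat \<Rightarrow> int \<Rightarrow> complex" where
  "unity_root n x = cis (2 * pi * real_of_int x / real n)"

lemma unity_root_0 [simp]: "unity_root n 0 = 1"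
  by (simp add: unity_root_def)

lemma unity_root_nonzero [simp]: "unity_root n x \<noteq> 0"
  by (simp add: unity_root_def)

lemma norm_unity_root [simp]: "norm (unity_root n x) = 1"
  by (simp add: unity_root_def)

lemma unity_root_add: "unity_root n (x + y) = unity_root n x * unity_root n y"
  by (simp add: unity_root_def cis_mult add_divide_distrib distrib_left)

lemma unity_root_power: "unity_root n x ^ k = unity_root n (int k * x)"
  by (simp add: unity_root_def Complex.DeMoivre mult_ac)

lemma cnj_unity_root: "cnj (unity_root n x) = unity_root n (- x)"
  by (simp add: unity_root_def cis_cnj)

lemma unity_root_mult_cancel: "m > 0 \<Longrightarrow> unity_root (n * m) (x * int m) = unity_root n x"
  by (simp add: unity_root_def mult.assoc)

lemma unity_root_eq_1_iff:
  assumes "n > 0"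
  shows "unity_root n x = 1 \<longleftrightarrow> int n dvd x"
proof
  assume "unity_root n x = 1"
  then obtain k :: int where "2 * pi * real_of_int x / real n = real_of_int k * (2 * pi)"
    unfolding unity_root_def
    by (metis cis.sel(1) cos_one_2pi_int mult.assoc mult.commute one_complex.sel(1))
  hence "real_of_int x = real_of_int (int n * k)"
    using assms by (simp add: field_simps)
  hence "x = int n * k" by (simp only: of_int_eq_iff)
  thus "int n dvd x" by simp
next
  assume "int n dvd x"
  then obtain k where "x = int n * k" by (rule dvdE)
  hence "2 * pi * real_of_int x / real n = 2 * pi * real_of_int k"
    using assms by (simp add: field_simps)
  thus "unity_root n x = 1" by (simp add: unity_root_def)
qed

lemma unity_root_cong:
  assumes "n > 0" "[x = y] (mod int n)"
  shows "unity_root n x = unity_root n y"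
proof -
  have "unity_root n (x - y) = 1"
    using assms by (simp add: unity_root_eq_1_iff cong_iff_dvd_diff)
  thus ?thesis using unity_root_add[of n "x - y" y] by simp
qed

text \<open>A map that is injective modulo \<open>n\<close> permutes the residues, so sums of periodic functions may
  be re-indexed by translations, by reflections and by multiplication with units.\<close>

lemma sum_residues_reindex:
  fixes F :: "int \<Rightarrow> 'a :: comm_monoid_add"
  assumes n: "n > 0"
    and F: "\<And>x y. [x = y] (mod int n) \<Longrightarrow> F x = F y"
    and \<phi>: "\<And>x y. [\<phi> x = \<phi> y] (mod int n) \<Longrightarrow> [x = y] (mod int n)"
  shows "(\<Sum>i\<in>{0..<int n}. F (\<phi> i)) = (\<Sum>i\<in>{0..<int n}. F i)"
proof -
  let ?R = "{0..<int n}"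
  have inj: "inj_on (\<lambda>i. \<phi> i mod int n) ?R"
  proof (rule inj_onI)
    fix x y assume xy: "x \<in> ?R" "y \<in> ?R" "\<phi> x mod int n = \<phi> y mod int n"
    have "[x = y] (mod int n)" by (rule \<phi>) (use xy(3) in \<open>simp add: cong_def\<close>)
    thus "x = y" using xy(1,2) by (simp add: cong_def)
  qed
  have "(\<lambda>i. \<phi> i mod int n) ` ?R \<subseteq> ?R" using n by auto
  with inj have "bij_betw (\<lambda>i. \<phi> i mod int n) ?R ?R"
    by (simp add: bij_betw_def endo_inj_surj)
  hence "(\<Sum>i\<in>?R. F (\<phi> i mod int n)) = (\<Sum>i\<in>?R. F i)"
    by (rule sum.reindex_bij_betw)
  moreover have "F (\<phi> i mod int n) = F (\<phi> i)" for i by (rule F) simp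
  ultimately show ?thesis by simp
qed

lemma sum_unity_root:
  assumes n: "n > 0"
  shows "(\<Sum>i\<in>{0..<int n}. unity_root n (x * i)) = (if int n dvd x then of_nat n else 0)"
proof (cases "int n dvd x")
  case True
  hence "unity_root n (x * i) = 1" for i using n by (simp add: unity_root_eq_1_iff)
  thus ?thesis using True by simp
next
  case False
  let ?s = "\<Sum>i\<in>{0..<int n}. unity_root n (x * i)"
  have "?s = (\<Sum>i\<in>{0..<int n}. unity_root n (x * (i + 1)))"
    by (rule sum_residues_reindex[symmetric])
       (use n in \<open>auto intro!: unity_root_cong cong_mult simp: cong_add_rcancel\<close>)
  also have "\<dots> = ?s * unity_root n x"
    by (simp add: distrib_left unity_root_add sum_distrib_right)
  finally have "?s * (unity_root n x - 1) = 0" by (simp add: algebra_simps)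
  moreover have "unity_root n x \<noteq> 1" using False n by (simp add: unity_root_eq_1_iff)
  ultimately show ?thesis using False by simp
qed

text \<open>The discrete Fourier transform of a function with period \<open>n\<close>; for the connection function of
  a circulant matrix its values are the eigenvalues.\<close>

definition char_sum :: "nat \<Rightarrow> (int \<Rightarrow> complex) \<Rightarrow> int \<Rightarrow> complex" where
  "char_sum n h j = (\<Sum>k\<in>{0..<int n}. h k * unity_root n (j * k))"

lemma char_sum_cong:
  assumes "n > 0" "[i = j] (mod int n)"
  shows "char_sum n h i = char_sum n h j"
proof -
  have "unity_root n (i * k) = unity_root n (j * k)" for k
    by (intro unity_root_cong cong_mult assms cong_refl)
  thus ?thesis by (simp add: char_sum_def)
qed

lemma fourier_inversion:
  assumes n: "n > 0" and k: "k \<in> {0..<int n}"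
  shows "(\<Sum>j\<in>{0..<int n}. char_sum n h j * unity_root n (- (j * k))) = of_nat n * h k"
proof -
  let ?R = "{0..<int n}"
  have "(\<Sum>j\<in>?R. char_sum n h j * unity_root n (- (j * k)))
      = (\<Sum>j\<in>?R. \<Sum>i\<in>?R. h i * unity_root n ((i - k) * j))"
  proof (rule sum.cong[OF refl])
    fix j
    have "j * i + - (j * k) = (i - k) * j" for i by (simp add: algebra_simps)
    hence "h i * unity_root n (j * i) * unity_root n (- (j * k)) = h i * unity_root n ((i - k) * j)" for i
      by (simp only: mult.assoc unity_root_add[symmetric])
    thus "char_sum n h j * unity_root n (- (j * k)) = (\<Sum>i\<in>?R. h i * unity_root n ((i - k) * j))"
      by (simp only: char_sum_def sum_distrib_right)
  qed
  also have "\<dots> = (\<Sum>i\<in>?R. h i * (\<Sum>j\<in>?R. unity_root n ((i - k) * j)))"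
    by (subst sum.swap) (simp add: sum_distrib_left)
  also have "\<dots> = (\<Sum>i\<in>?R. if i = k then of_nat n * h i else 0)"
  proof (rule sum.cong[OF refl])
    fix i assume "i \<in> ?R"
    hence "int n dvd i - k \<longleftrightarrow> i = k"
      using k by (auto simp: mod_eq_dvd_iff[symmetric])
    thus "h i * (\<Sum>j\<in>?R. unity_root n ((i - k) * j)) = (if i = k then of_nat n * h i else 0)"
      using n by (simp add: sum_unity_root)
  qed
  also have "\<dots> = of_nat n * h k" using k by simp
  finally show ?thesis .
qed

section \<open>Eigenvalues of circulant matrices\<close>

lemma sum_nat_residues: "(\<Sum>i<n. F (int i)) = (\<Sum>i\<in>{0..<int n}. F i)"
  by (rule sum.reindex_bij_witness[of _ nat int]) auto

lemma char_sum_translate: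
  assumes n: "n > 0" and h: "\<And>x y. [x = y] (mod int n) \<Longrightarrow> h x = h y"
  shows "(\<Sum>v\<in>{0..<int n}. h (v - u) * unity_root n (j * v)) = char_sum n h j * unity_root n (j * u)"
proof -
  let ?F = "\<lambda>k. h k * unity_root n (j * k)"
  have "(\<Sum>v\<in>{0..<int n}. h (v - u) * unity_root n (j * v))
      = (\<Sum>v\<in>{0..<int n}. ?F (v - u) * unity_root n (j * u))"
    by (simp only: mult.assoc unity_root_add[symmetric] distrib_left[symmetric] diff_add_cancel)
  also have "\<dots> = (\<Sum>v\<in>{0..<int n}. ?F (v - u)) * unity_root n (j * u)"
    by (simp add: sum_distrib_right)
  also have "(\<Sum>v\<in>{0..<int n}. ?F (v - u)) = (\<Sum>v\<in>{0..<int n}. ?F v)"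
  proof (rule sum_residues_reindex[OF n])
    fix x y assume "[x = y] (mod int n)"
    thus "?F x = ?F y"
      using h[of x y] unity_root_cong[OF n, of "j * x" "j * y"] by (simp add: cong_scalar_left)
  next
    fix x y assume "[x - u = y - u] (mod int n)"
    thus "[x = y] (mod int n)" by (simp add: cong_iff_dvd_diff)
  qed
  finally show ?thesis by (simp add: char_sum_def)
qed

lemma char_sum_reflect:
  assumes n: "n > 0" and h: "\<And>x y. [x = y] (mod int n) \<Longrightarrow> h x = h y"
  shows "(\<Sum>u\<in>{0..<int n}. h (w - u) * unity_root n (- j * u)) = char_sum n h j * unity_root n (- j * w)"
proof -
  let ?F = "\<lambda>k. h k * unity_root n (j * k)"
  have *: "j * (w - u) + - j * w = - j * u" for u by (simp add: algebra_simps)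
  have "(\<Sum>u\<in>{0..<int n}. h (w - u) * unity_root n (- j * u))
      = (\<Sum>u\<in>{0..<int n}. ?F (w - u)) * unity_root n (- j * w)"
    by (simp only: sum_distrib_right mult.assoc unity_root_add[symmetric] *)
  also have "(\<Sum>u\<in>{0..<int n}. ?F (w - u)) = (\<Sum>u\<in>{0..<int n}. ?F u)"
  proof (rule sum_residues_reindex[OF n])
    fix x y assume "[x = y] (mod int n)"
    thus "?F x = ?F y"
      using h[of x y] unity_root_cong[OF n, of "j * x" "j * y"] by (simp add: cong_scalar_left)
  next
    fix x y assume "[w - x = w - y] (mod int n)"
    hence "int n dvd y - x" by (simp add: cong_iff_dvd_diff)
    thus "[x = y] (mod int n)" by (simp add: cong_iff_dvd_diff dvd_diff_commute)
  qed
  finally show ?thesis by (simp add: char_sum_def)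
qed

text \<open>Every Fourier coefficient is an eigenvalue because the characters are eigenvectors.
  Conversely, the Fourier transform turns \<open>A v = x v\<close> into the pointwise identity \<open>x w = \<gamma> w\<close>
  between the transform \<open>w\<close> of \<open>v\<close> and the transform \<open>\<gamma>\<close> of \<open>h\<close>, and \<open>w\<close> is
  nonzero somewhere by Fourier inversion.\<close>

lemma eigenvalue_circulant:
  assumes n: "n > 0" and h: "\<And>x y. [x = y] (mod int n) \<Longrightarrow> h x = h y"
  shows "eigenvalue (mat n n (\<lambda>(u, v). h (int v - int u))) x \<longleftrightarrow> (\<exists>j. x = char_sum n h j)"
    (is "eigenvalue ?A x \<longleftrightarrow> _")
proof
  assume "\<exists>j. x = char_sum n h j"
  then obtain j where j: "x = char_sum n h j" ..
  let ?v = "vec n (\<lambda>i. unity_root n (j * int i))"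
  have "?A *\<^sub>v ?v = x \<cdot>\<^sub>v ?v"
  proof (rule eq_vecI)
    fix u assume "u < dim_vec (x \<cdot>\<^sub>v ?v)"
    hence u: "u < n" by simp
    have "(?A *\<^sub>v ?v) $ u = (\<Sum>v<n. h (int v - int u) * unity_root n (j * int v))"
      using u by (simp add: scalar_prod_def lessThan_atLeast0)
    also have "\<dots> = x * unity_root n (j * int u)"
      unfolding j sum_nat_residues[of "\<lambda>v. h (v - int u) * unity_root n (j * v)"]
      by (rule char_sum_translate[OF n]) (rule h)
    finally show "(?A *\<^sub>v ?v) $ u = (x \<cdot>\<^sub>v ?v) $ u" using u by simp
  qed simp
  moreover have "?v \<noteq> 0\<^sub>v n"
  proof
    assume "?v = 0\<^sub>v n"
    hence "?v $ 0 = 0\<^sub>v n $ 0" by (rule arg_cong)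
    thus False using n by simp
  qed
  ultimately have "eigenvector ?A ?v x" by (simp add: eigenvector_def)
  thus "eigenvalue ?A x" unfolding eigenvalue_def ..
next
  assume "eigenvalue ?A x"
  then obtain v where v: "v \<in> carrier_vec n" "v \<noteq> 0\<^sub>v n" "?A *\<^sub>v v = x \<cdot>\<^sub>v v"
    by (auto simp: eigenvalue_def eigenvector_def)
  define V where "V i = v $ nat i" for i
  let ?R = "{0..<int n}"
  have V: "(\<Sum>w\<in>?R. h (w - u) * V w) = x * V u" if "u \<in> ?R" for u
  proof -
    have u: "nat u < n" "int (nat u) = u" using that by auto
    have "x * V u = (?A *\<^sub>v v) $ nat u" using u v(1,3) by (simp add: V_def)
    also have "\<dots> = (\<Sum>w<n. h (int w - u) * V (int w))"
      using u v(1) by (auto simp add: scalar_prod_def lessThan_atLeast0 V_def)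
    finally show ?thesis by (subst (asm) sum_nat_residues) simp
  qed
  \<comment> \<open>\<open>V\<close> is not periodic, so the re-indexing takes place in the sum over \<open>u\<close>, which
    involves only \<open>h\<close> and a character.\<close>
  have eig: "x * char_sum n V (- j) = char_sum n h j * char_sum n V (- j)" for j
  proof -
    have "x * char_sum n V (- j) = (\<Sum>u\<in>?R. (\<Sum>w\<in>?R. h (w - u) * V w) * unity_root n (- j * u))"
      by (simp add: V char_sum_def sum_distrib_left mult.assoc)
    also have "\<dots> = (\<Sum>w\<in>?R. V w * (\<Sum>u\<in>?R. h (w - u) * unity_root n (- j * u)))"
      by (simp add: sum_distrib_left sum_distrib_right mult_ac) (rule sum.swap)
    also have "\<dots> = (\<Sum>w\<in>?R. V w * (char_sum n h j * unity_root n (- j * w)))"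
    proof -
      have "(\<Sum>u\<in>?R. h (w - u) * unity_root n (- j * u)) = char_sum n h j * unity_root n (- j * w)" for w
        by (rule char_sum_reflect[OF n]) (rule h)
      thus ?thesis by (simp only:)
    qed
    also have "\<dots> = char_sum n h j * char_sum n V (- j)"
      by (simp add: char_sum_def[of n V] sum_distrib_left mult_ac)
    finally show ?thesis .
  qed
  have "\<exists>j. char_sum n V j \<noteq> 0"
  proof (rule ccontr)
    assume "\<nexists>j. char_sum n V j \<noteq> 0"
    hence "V k = 0" if "k \<in> ?R" for k using fourier_inversion[OF n that, of V] n by simp
    hence "v $ i = 0" if "i < n" for i using that by (auto simp: V_def dest: meta_spec[of _ "int i"])
    hence "v = 0\<^sub>v n" using v(1) by auto
    with v(2) show False ..
  qed
  then obtain j where "char_sum n V (- (- j)) \<noteq> 0" by auto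
  with eig[of "- j"] show "\<exists>j. x = char_sum n h j" by auto
qed

section \<open>A Frobenius congruence for sums of roots of unity\<close>

lemma prime_dvd_add_power_diff:
  fixes a b :: "'a :: comm_ring_1"
  assumes p: "prime (p :: nat)"
  shows "of_nat p dvd (a + b) ^ p - (a ^ p + b ^ p)"
proof -
  have p0: "p > 0" using p by (rule prime_gt_0_nat)
  let ?t = "\<lambda>k. of_nat (p choose k) * a ^ k * b ^ (p - k)"
  have split: "{..p} = insert 0 (insert p {0<..<p})" using p0 by auto
  have "(a + b) ^ p = (\<Sum>k\<le>p. ?t k)" by (rule binomial_ring)
  also have "\<dots> = b ^ p + (a ^ p + (\<Sum>k\<in>{0<..<p}. ?t k))"
    unfolding split using p0 by simp
  finally have "(a + b) ^ p - (a ^ p + b ^ p) = (\<Sum>k\<in>{0<..<p}. ?t k)" by simp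
  moreover have "of_nat p dvd ?t k" if "k \<in> {0<..<p}" for k
  proof -
    have "p dvd (p choose k)" by (rule dvd_choose_prime) (use that p in auto)
    then obtain c where "p choose k = p * c" by (rule dvdE)
    thus ?thesis by (simp add: mult.assoc)
  qed
  ultimately show ?thesis by (simp only:) (rule dvd_sum)
qed

lemma prime_dvd_sum_power_diff:
  fixes f :: "'b \<Rightarrow> 'a :: comm_ring_1"
  assumes p: "prime (p :: nat)"
  shows "of_nat p dvd (\<Sum>i\<in>I. f i) ^ p - (\<Sum>i\<in>I. f i ^ p)"
proof (induction I rule: infinite_finite_induct)
  case (insert x I)
  have "of_nat p dvd ((f x + sum f I) ^ p - (f x ^ p + sum f I ^ p)) + (sum f I ^ p - (\<Sum>i\<in>I. f i ^ p))"
    by (intro dvd_add prime_dvd_add_power_diff p insert.IH)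
  thus ?case using insert.hyps by (simp add: algebra_simps)
qed (use prime_gt_0_nat[OF p] in \<open>simp_all add: zero_power\<close>)

lemma int_power_prime_cong:
  fixes a :: int
  assumes p: "prime (p :: nat)"
  shows "[a ^ p = a] (mod int p)"
proof -
  define b where "b = nat (a mod int p)"
  have b: "[a = int b] (mod int p)" using prime_gt_0_nat[OF p] by (simp add: b_def)
  have "int p dvd (\<Sum>i<b. 1) ^ p - (\<Sum>i<b. 1 ^ p)"
    using prime_dvd_sum_power_diff[OF p, of "\<lambda>_. 1 :: int" "{..<b}"] by simp
  hence "[int b ^ p = int b] (mod int p)" by (simp add: cong_iff_dvd_diff)
  with b show ?thesis by (meson cong_pow cong_sym cong_trans)
qed

text \<open>Multiplication by \<open>Q(z)\<close> maps the integer span of \<open>1, z, \<dots>, z\<^bsup>N-1\<^esup>\<close> to itself, so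
  \<open>Q(z)\<close> is an eigenvalue of an integer matrix and a root of its monic characteristic polynomial.\<close>

lemma algebraic_int_poly_root_of_unity:
  fixes z :: complex
  assumes z: "z ^ N = 1" and N: "N > 0"
  shows "algebraic_int (poly (map_poly of_int Q) z)"
proof -
  let ?x = "poly (map_poly of_int Q) z :: complex"
  define A :: "int mat" where
    "A = mat N N (\<lambda>(i, j). \<Sum>k\<le>degree Q. if (i + k) mod N = j then coeff Q k else 0)"
  let ?A = "map_mat of_int A :: complex mat"
  let ?v = "vec N (\<lambda>i. z ^ i)"
  have A: "A \<in> carrier_mat N N" "?A \<in> carrier_mat N N" by (auto simp: A_def)
  have zmod: "z ^ (m mod N) = z ^ m" for m
  proof -
    have "z ^ m = z ^ (N * (m div N) + m mod N)" by simp
    also have "\<dots> = z ^ (m mod N)" unfolding power_add power_mult z by simp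
    finally show ?thesis ..
  qed
  have x: "?x = (\<Sum>k\<le>degree Q. of_int (coeff Q k) * z ^ k)"
    by (simp add: poly_altdef)
  have "?A *\<^sub>v ?v = ?x \<cdot>\<^sub>v ?v"
  proof (rule eq_vecI)
    fix i assume "i < dim_vec (?x \<cdot>\<^sub>v ?v)"
    hence i: "i < N" by simp
    have "(?A *\<^sub>v ?v) $ i =
        (\<Sum>j<N. of_int (\<Sum>k\<le>degree Q. if (i + k) mod N = j then coeff Q k else 0) * z ^ j)"
      using i by (simp add: scalar_prod_def lessThan_atLeast0 A_def)
    also have "\<dots> = (\<Sum>j<N. \<Sum>k\<le>degree Q. if (i + k) mod N = j then of_int (coeff Q k) * z ^ j else 0)"
      by (simp add: sum_distrib_right if_distrib[of "\<lambda>x. of_int x * _"] cong: if_cong)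
    also have "\<dots> = (\<Sum>k\<le>degree Q. \<Sum>j<N. if (i + k) mod N = j then of_int (coeff Q k) * z ^ j else 0)"
      by (rule sum.swap)
    also have "\<dots> = (\<Sum>k\<le>degree Q. of_int (coeff Q k) * z ^ (i + k))"
      using N by (simp add: zmod)
    also have "\<dots> = ?x * z ^ i"
      unfolding x sum_distrib_right by (simp add: power_add mult_ac)
    finally show "(?A *\<^sub>v ?v) $ i = (?x \<cdot>\<^sub>v ?v) $ i" using i by simp
  qed (simp add: A_def)
  moreover have "?v \<noteq> 0\<^sub>v N"
  proof
    assume "?v = 0\<^sub>v N"
    hence "?v $ 0 = 0\<^sub>v N $ 0" by (rule arg_cong)
    thus False using N by simp
  qed
  ultimately have "eigenvector ?A ?v ?x" by (simp add: eigenvector_def A_def)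
  hence "poly (char_poly ?A) ?x = 0"
    using eigenvalue_root_char_poly[OF A(2)] unfolding eigenvalue_def by blast
  hence "poly (map_poly of_int (char_poly A)) ?x = 0"
    by (simp add: of_int_hom.char_poly_hom[OF A(1)])
  moreover have "lead_coeff (char_poly A) = 1"
    using degree_monic_char_poly[OF A(1)] by simp
  ultimately show ?thesis unfolding algebraic_int_altdef_ipoly by blast
qed

text \<open>In \<open>\<int>[z]\<close>, with \<open>z\<close> a primitive \<open>N\<close>-th root of unity, the \<open>p\<close>-th power map is
  additive modulo \<open>p\<close>. If both sums are integers, their difference divided by \<open>p\<close> is a rational
  algebraic integer, so the congruence already holds in \<open>\<int>\<close>. The additivity is shown for
  integer polynomials, which are then evaluated at \<open>z\<close>.\<close>

lemma cong_power_sum_roots_of_unity: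
  fixes f :: "'b \<Rightarrow> complex"
  assumes p: "prime (p :: nat)" and N: "N > 0"
    and f: "\<And>i. i \<in> I \<Longrightarrow> f i = 0 \<or> f i ^ N = 1"
    and a: "(\<Sum>i\<in>I. f i) = of_int a" and b: "(\<Sum>i\<in>I. f i ^ p) = of_int b"
  shows "[a = b] (mod int p)"
proof -
  define z where "z = unity_root N 1"
  have z: "z ^ N = 1" using N by (simp add: z_def unity_root_power unity_root_eq_1_iff)
  have "\<exists>M. poly (map_poly of_int M) z = f i" if "i \<in> I" for i
  proof (cases "f i = 0")
    case True
    thus ?thesis by (intro exI[of _ 0]) simp
  next
    case False
    hence "f i \<in> {w. w ^ N = 1}" using f[OF that] by simp
    also have "\<dots> = (\<lambda>k. cis (2 * pi * real k / real N)) ` {..<N}"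
      using bij_betw_roots_unity[OF N] by (simp add: bij_betw_def)
    finally obtain k where "f i = cis (2 * pi * real k / real N)" by auto
    hence "f i = z ^ k" by (simp add: z_def unity_root_power) (simp add: unity_root_def)
    thus ?thesis by (intro exI[of _ "monom 1 k"]) (simp add: map_poly_monom poly_monom)
  qed
  hence "\<exists>M. \<forall>i\<in>I. poly (map_poly of_int (M i)) z = f i" by (intro bchoice ballI)
  then obtain M where M: "\<And>i. i \<in> I \<Longrightarrow> poly (map_poly of_int (M i)) z = f i" by blast
  let ?e = "\<lambda>P :: int poly. poly (map_poly of_int P) z"
  obtain R where R: "(\<Sum>i\<in>I. M i) ^ p - (\<Sum>i\<in>I. M i ^ p) = of_nat p * R"
    using prime_dvd_sum_power_diff[OF p, of M I] by (rule dvdE)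
  have "?e ((\<Sum>i\<in>I. M i) ^ p - (\<Sum>i\<in>I. M i ^ p)) = (\<Sum>i\<in>I. ?e (M i)) ^ p - (\<Sum>i\<in>I. ?e (M i) ^ p)"
    by (simp add: hom_distribs poly_sum)
  also have "(\<Sum>i\<in>I. ?e (M i)) = (\<Sum>i\<in>I. f i)" by (simp add: M)
  also have "(\<Sum>i\<in>I. ?e (M i) ^ p) = (\<Sum>i\<in>I. f i ^ p)" by (simp add: M)
  finally have "of_int (a ^ p - b) = ?e (of_nat p * R)" by (simp add: R a b)
  also have "\<dots> = of_nat p * ?e R" by (simp add: hom_distribs)
  finally have eq: "of_int (a ^ p - b) = of_nat p * ?e R" .
  have p0: "p > 0" using p by (rule prime_gt_0_nat)
  have "?e R = of_int (a ^ p - b) / of_nat p" unfolding eq using p0 by simp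
  hence "?e R \<in> \<rat>" by simp
  with algebraic_int_poly_root_of_unity[OF z N] have "?e R \<in> \<int>"
    by (rule rational_algebraic_int_is_int)
  then obtain m where "?e R = of_int m" by (elim Ints_cases)
  with eq have "(of_int (a ^ p - b) :: complex) = of_int (int p * m)" by simp
  hence "a ^ p - b = int p * m" by (simp only: of_int_eq_iff)
  hence "[a ^ p = b] (mod int p)" by (simp add: cong_iff_dvd_diff)
  with int_power_prime_cong[OF p, of a] show ?thesis by (meson cong_sym cong_trans)
qed

text \<open>The Chinese remainder theorem imposes \<open>m \<equiv> 1\<close> modulo the primes that divide \<open>K\<close> but not
  \<open>M\<close>; the primes dividing both are excluded by the class \<open>a\<close> itself. For \<open>K\<close> a factorial
  this yields a representative of \<open>a\<close> all of whose prime factors are large, which serves the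
  purpose of a prime in an arithmetic progression.\<close>

lemma ex_cong_coprime:
  fixes M :: nat and a :: int
  assumes M: "M > 0" and K: "K > 0" and a: "coprime a (int M)"
  shows "\<exists>m :: nat. [int m = a] (mod int M) \<and> coprime m K"
proof -
  define Q where "Q = \<Prod>{q. prime q \<and> q dvd K \<and> \<not> q dvd M}"
  have fin: "finite {q. prime q \<and> q dvd K \<and> \<not> q dvd M}"
    by (rule finite_subset[of _ "{..K}"]) (use K in \<open>auto dest: dvd_imp_le\<close>)
  have "coprime M Q" unfolding Q_def
    by (rule prod_coprime_right) (auto intro: prime_imp_coprime simp: coprime_commute[of M])
  then obtain m where m: "[m = nat (a mod int M)] (mod M)" "[m = 1] (mod Q)"
    using binary_chinese_remainder_nat by blast
  have mM: "[int m = a] (mod int M)"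
    using m(1) M by (simp add: cong_int_iff[symmetric])
  have "coprime m K"
  proof (rule ccontr)
    assume "\<not> coprime m K"
    hence "gcd m K \<noteq> 1" by (simp add: coprime_iff_gcd_eq_1)
    then obtain q where "prime q" "q dvd gcd m K" using prime_factor_nat by blast
    hence q: "prime q" "q dvd m" "q dvd K" by auto
    show False
    proof (cases "q dvd M")
      case True
      hence "[int m = a] (mod int q)" using mM by (meson cong_dvd_modulus int_dvd_int_iff)
      hence "int q dvd a" using q(2) by (simp add: cong_dvd_iff[symmetric])
      moreover have "int q dvd int M" using True by simp
      ultimately have "is_unit (int q)" by (rule coprime_common_divisor[OF a])
      thus False using q(1) by simp
    next
      case False
      hence "q dvd Q" using q fin by (auto simp: Q_def intro!: dvd_prodI)
      hence "[m = 1] (mod q)" by (rule cong_dvd_modulus_nat[OF m(2)])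
      hence "q dvd 1" using q(2) cong_dvd_iff by blast
      thus False using q(1) by simp
    qed
  qed
  with mM show ?thesis by blast
qed

section \<open>Integral Fourier coefficients force dilation invariance\<close>

lemma unity_root_six_power:
  assumes p: "odd p" "[int p = s] (mod 3)" "s \<in> {1, -1}" and t: "t \<in> {0, unity_root 6 1, unity_root 6 (-1)}"
  shows "t ^ p = (if s = 1 then t else cnj t)"
proof -
  have "[int p = s] (mod 6)" using p(1,2,3) by (auto simp: cong_def) presburger+
  hence e: "unity_root 6 (int p * e) = unity_root 6 (s * e)" for e
    by (intro unity_root_cong cong_mult) simp_all
  have "p > 0" using p(1) by (cases p) auto
  thus ?thesis using p(3) t e[of 1] e[of "-1"] by (auto simp: unity_root_power cnj_unity_root)
qed

lemma unity_root_power_self: "n > 0 \<Longrightarrow> unity_root n x ^ n = 1"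
  by (simp add: unity_root_power unity_root_eq_1_iff)

text \<open>The following lemmas concern an arbitrary periodic function \<open>h\<close> with values \<open>0\<close> and
  \<open>(1 \<plusminus> \<i> \<surd>3) / 2\<close>, all of whose Fourier coefficients are integers.\<close>

context
  fixes n :: nat and h :: "int \<Rightarrow> complex"
  assumes n: "n \<ge> 2"
    and h_cong: "\<And>x y. [x = y] (mod int n) \<Longrightarrow> h x = h y"
    and h_vals: "\<And>x. h x \<in> {0, unity_root 6 1, unity_root 6 (-1)}"
    and ints: "\<And>j. char_sum n h j \<in> \<int>"
begin

lemma norm_char_sum_le: "norm (char_sum n h j) \<le> real n"
proof -
  have "norm (char_sum n h j) \<le> (\<Sum>k\<in>{0..<int n}. norm (h k * unity_root n (j * k)))"
    unfolding char_sum_def by (rule norm_sum)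
  also have "\<dots> \<le> (\<Sum>k\<in>{0..<int n}. 1)"
  proof (rule sum_mono)
    fix k show "norm (h k * unity_root n (j * k)) \<le> 1"
      using h_vals[of k] by (auto simp: norm_mult)
  qed
  finally show ?thesis by simp
qed

text \<open>For a prime \<open>p \<equiv> 1 (mod 3)\<close> the \<open>p\<close>-th power map fixes the values of \<open>h\<close>, for
  \<open>p \<equiv> -1 (mod 3)\<close> it conjugates them; the sign \<open>s\<close> absorbs the conjugation, since the
  coefficients are real. So the coefficients at \<open>s p j\<close> and \<open>j\<close> agree modulo \<open>p\<close>. They
  have absolute value at most \<open>n\<close>, so for \<open>p > 2 n\<close> they are equal.\<close>

lemma char_sum_large_prime:
  assumes p: "prime p" "p > 2 * n" and s: "[int p = s] (mod 3)" "s \<in> {1, -1}"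
  shows "char_sum n h (s * int p * j) = char_sum n h j"
proof -
  have "odd p" using p n by (intro prime_odd_nat) auto
  obtain a where a: "char_sum n h j = of_int a" using ints[of j] by (elim Ints_cases)
  obtain b where b: "char_sum n h (s * int p * j) = of_int b"
    using ints[of "s * int p * j"] by (elim Ints_cases)
  let ?f = "\<lambda>k. h k * unity_root n (j * k)"
  have "(\<Sum>k\<in>{0..<int n}. ?f k ^ p) = of_int b"
  proof (cases "s = 1")
    case True
    have "?f k ^ p = h k * unity_root n (s * int p * j * k)" for k
      using unity_root_six_power[OF \<open>odd p\<close> s h_vals[of k]] True
      by (simp add: power_mult_distrib unity_root_power mult_ac)
    thus ?thesis using b by (simp add: char_sum_def)
  next
    case False
    hence s': "s = -1" using s by simp
    have "?f k ^ p = cnj (h k * unity_root n (s * int p * j * k))" for k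
      using unity_root_six_power[OF \<open>odd p\<close> s h_vals[of k]] s'
      by (simp add: power_mult_distrib unity_root_power cnj_unity_root mult_ac)
    hence "(\<Sum>k\<in>{0..<int n}. ?f k ^ p) = cnj (char_sum n h (s * int p * j))"
      by (simp add: char_sum_def)
    thus ?thesis using b by simp
  qed
  moreover have "?f k = 0 \<or> ?f k ^ (6 * n) = 1" for k
  proof -
    have "unity_root n (j * k) ^ (n * 6) = 1" "unity_root 6 e ^ (6 * n) = 1" for e
      using n unity_root_power_self[of 6] by (simp_all only: power_mult) (simp_all add: unity_root_power_self)
    thus ?thesis using h_vals[of k] by (auto simp: power_mult_distrib mult.commute[of n 6])
  qed
  ultimately have "[a = b] (mod int p)"
    using n a by (intro cong_power_sum_roots_of_unity[OF p(1), of "6 * n" "{0..<int n}" ?f])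
      (simp_all add: char_sum_def)
  hence dvd: "int p dvd a - b" by (simp add: cong_iff_dvd_diff)
  have "\<bar>a\<bar> \<le> int n" "\<bar>b\<bar> \<le> int n"
    using norm_char_sum_le[of j] norm_char_sum_le[of "s * int p * j"] a b by simp_all
  hence "\<bar>a - b\<bar> < int p" using p(2) by linarith
  hence "a = b" using dvd_imp_le_int[OF _ dvd] by fastforce
  thus ?thesis using a b by simp
qed

lemma char_sum_large_prime_factors:
  assumes "m > 0" "\<And>p. prime p \<Longrightarrow> p dvd m \<Longrightarrow> p > 2 * n" "[int m = s] (mod 3)" "s \<in> {1, -1}"
  shows "char_sum n h (s * int m * j) = char_sum n h j"
  using assms
proof (induction m arbitrary: s j rule: less_induct)
  case (less m)
  show ?case
  proof (cases "m = 1")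
    case True
    hence "s = 1" using less.prems(3,4) by (auto simp: cong_def)
    thus ?thesis using True by simp
  next
    case False
    then obtain p where p: "prime p" "p dvd m" using prime_factor_nat by blast
    then obtain m' where m': "m = p * m'" by (elim dvdE)
    have large: "p > 2 * n" using less.prems(2) p by blast
    have "\<not> 3 dvd p" using p(1) large n by (auto simp: prime_nat_iff)
    then obtain r where r: "[int p = r] (mod 3)" "r \<in> {1, -1}"
    proof -
      have "int p mod 3 = 1 \<or> int p mod 3 = 2" using \<open>\<not> 3 dvd p\<close> by presburger
      thus ?thesis using that[of 1] that[of "-1"] by (auto simp: cong_def)
    qed
    have rr: "r * r = 1" using r by auto
    have "[int p * int m' = s] (mod 3)" using less.prems(3) m' by simp
    hence "[r * int m' = s] (mod 3)"
      using r(1) by (meson cong_scalar_right cong_sym cong_trans)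
    hence "[r * (r * int m') = r * s] (mod 3)" by (rule cong_scalar_left)
    hence s': "[int m' = r * s] (mod 3)" using rr by (simp add: mult.assoc[symmetric])
    have "char_sum n h (r * s * int m' * j') = char_sum n h j'" for j'
    proof (rule less.IH)
      show "m' < m" "m' > 0" using m' less.prems(1) prime_gt_1_nat[OF p(1)] by auto
      show "q > 2 * n" if "prime q" "q dvd m'" for q using less.prems(2) that m' by auto
      show "r * s \<in> {1, -1}" using r less.prems(4) by auto
    qed (rule s')
    moreover have "s * int m * j = r * int p * (r * s * int m' * j)"
    proof -
      have "r * int p * (r * s * int m' * j) = (r * r) * (s * int (p * m') * j)" by simp
      thus ?thesis by (simp add: rr m')
    qed
    ultimately show ?thesis using char_sum_large_prime[OF p(1) large r] by metis
  qed
qed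

text \<open>The coefficient at \<open>a j\<close> depends only on \<open>a\<close> modulo \<open>n\<close>, so \<open>a\<close> may be replaced
  by an integer congruent to it modulo \<open>3 n\<close> that has only large prime factors. The modulus
  \<open>3 n\<close> instead of \<open>n\<close> preserves the residue modulo 3 when \<open>n\<close> is prime to 3.\<close>

lemma char_sum_dilate:
  assumes a: "coprime a (int n)" "[a = 1] (mod 3)"
  shows "char_sum n h (a * j) = char_sum n h j"
proof -
  have "coprime a 3" using a(2) by (meson cong_imp_coprime cong_sym coprime_1_left)
  hence "coprime a (int (3 * n))" using a(1) by simp
  then obtain m where m: "[int m = a] (mod int (3 * n))" "coprime m (fact (2 * n))"
    using ex_cong_coprime[of "3 * n" "fact (2 * n)" a] n by auto
  have mn: "[int m = a] (mod int n)" by (rule cong_dvd_modulus[OF m(1)]) simp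
  have "[int m = a] (mod 3)" by (rule cong_dvd_modulus[OF m(1)]) simp
  hence m3: "[int m = 1] (mod 3)" using a(2) by (rule cong_trans)
  have "fact (2 * n) \<ge> (fact 2 :: nat)" using n by (intro fact_mono_nat) simp
  hence "m > 0" using m(2) by (cases m) auto
  moreover have "p > 2 * n" if p: "prime p" "p dvd m" for p
  proof (rule ccontr)
    assume "\<not> p > 2 * n"
    hence "p dvd fact (2 * n)" using p(1) by (simp add: prime_dvd_fact_iff)
    hence "is_unit p" using m(2) p(2) by (meson coprime_common_divisor)
    thus False using p(1) by simp
  qed
  ultimately have "char_sum n h (1 * int m * j) = char_sum n h j"
    using m3 by (intro char_sum_large_prime_factors) auto
  moreover have "char_sum n h (a * j) = char_sum n h (int m * j)"
    using mn n by (intro char_sum_cong cong_scalar_right) (auto intro: cong_sym)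
  ultimately show ?thesis by simp
qed

lemma dilation_invariant:
  assumes a: "coprime a (int n)" "[a = 1] (mod 3)"
  shows "h (a * k) = h k"
proof -
  have n0: "n > 0" using n by simp
  let ?R = "{0..<int n}"
  have inv: "(\<Sum>j\<in>?R. char_sum n h j * unity_root n (- (j * k))) = of_nat n * h k" for k
  proof -
    have "[k mod int n = k] (mod int n)" by simp
    hence "unity_root n (- (j * (k mod int n))) = unity_root n (- (j * k))" for j
      using n0 by (intro unity_root_cong) (auto simp: cong_minus_minus_iff intro: cong_scalar_left)
    thus ?thesis
      using fourier_inversion[OF n0, of "k mod int n" h] h_cong[of "k mod int n" k] n0 by simp
  qed
  let ?F = "\<lambda>j. char_sum n h j * unity_root n (- (j * k))"
  have "of_nat n * h k = (\<Sum>j\<in>?R. ?F j)" by (simp add: inv)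
  also have "\<dots> = (\<Sum>j\<in>?R. ?F (a * j))"
  proof (rule sum_residues_reindex[OF n0, symmetric])
    fix x y assume "[x = y] (mod int n)"
    thus "?F x = ?F y"
      using n0 by (intro arg_cong2[of _ _ _ _ "(*)"] char_sum_cong unity_root_cong)
        (auto simp: cong_minus_minus_iff intro: cong_scalar_right)
  next
    fix x y assume "[a * x = a * y] (mod int n)"
    thus "[x = y] (mod int n)" using a(1) by (simp add: cong_mult_lcancel)
  qed
  also have "\<dots> = (\<Sum>j\<in>?R. char_sum n h j * unity_root n (- (j * (a * k))))"
    unfolding char_sum_dilate[OF a] by (simp add: mult_ac)
  also have "\<dots> = of_nat n * h (a * k)" by (rule inv)
  finally show ?thesis using n by simp
qed

end

section \<open>The connection function of an oriented circulant graph\<close>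

text \<open>For a skew-symmetric \<open>S\<close> at most one of the two membership conditions holds, and this is
  the entry of the adjacency matrix at \<open>(u, v)\<close> as a function of \<open>v - u\<close>.\<close>

definition circ_weight :: "nat \<Rightarrow> nat set \<Rightarrow> int \<Rightarrow> complex" where
  "circ_weight n S x =
     (if nat (x mod int n) \<in> S then unity_root 6 1
      else if nat (- x mod int n) \<in> S then unity_root 6 (-1) else 0)"

lemma unity_root_6: "unity_root 6 1 = (1 + \<i> * complex_of_real (sqrt 3)) / 2"
    "unity_root 6 (-1) = (1 - \<i> * complex_of_real (sqrt 3)) / 2"
proof -
  have "unity_root 6 1 = Complex (1 / 2) (sqrt 3 / 2)"
    using cos_60 sin_60 by (simp add: unity_root_def complex_eq_iff)
  moreover have "unity_root 6 (-1) = cnj (unity_root 6 1)" by (simp add: cnj_unity_root)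
  ultimately show "unity_root 6 1 = (1 + \<i> * complex_of_real (sqrt 3)) / 2"
    "unity_root 6 (-1) = (1 - \<i> * complex_of_real (sqrt 3)) / 2"
    by (simp_all add: complex_eq_iff)
qed

lemma unity_root_6_neq: "unity_root 6 (-1) \<noteq> unity_root 6 1"
  unfolding unity_root_6 by (simp add: complex_eq_iff)

lemma circ_weight_cong: "[x = y] (mod int n) \<Longrightarrow> circ_weight n S x = circ_weight n S y"
  using cong_minus_minus_iff[of x y "int n"] by (simp add: circ_weight_def cong_def)

lemma circ_weight_vals: "circ_weight n S x \<in> {0, unity_root 6 1, unity_root 6 (-1)}"
  by (simp add: circ_weight_def)

lemma circ_weight_eq_iff: "circ_weight n S x = unity_root 6 1 \<longleftrightarrow> nat (x mod int n) \<in> S"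
  using unity_root_6_neq unity_root_nonzero[of 6 1] by (auto simp: circ_weight_def)

lemma skew_symmetric_uminus:
  assumes "skew_symmetric n S" "n > 0" "nat (x mod int n) \<in> S"
  shows "nat (- x mod int n) \<notin> S"
proof -
  have "nat (- int (nat (x mod int n)) mod int n) \<notin> S"
    using assms by (auto simp: skew_symmetric_def)
  thus ?thesis using assms(2) by (simp add: mod_minus_eq)
qed

lemma hermitian_adjacency2_Circ:
  assumes "skew_symmetric n S" "n > 0"
  shows "hermitian_adjacency2 (Circ n S) = mat n n (\<lambda>(u, v). circ_weight n S (int v - int u))"
proof -
  have "u < n \<Longrightarrow> v < n \<Longrightarrow>
     (if (u, v) \<in> parcs (Circ n S) \<and> (v, u) \<in> parcs (Circ n S) then 1
          else if (u, v) \<in> parcs (Circ n S) then (1 + \<i> * complex_of_real (sqrt 3)) / 2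
          else if (v, u) \<in> parcs (Circ n S) then (1 - \<i> * complex_of_real (sqrt 3)) / 2
          else 0) = circ_weight n S (int v - int u)" for u v
    using skew_symmetric_uminus[OF assms, of "int v - int u"]
    unfolding circ_weight_def unity_root_6 by (auto simp: Circ_def)
  thus ?thesis
    unfolding hermitian_adjacency2_def by (intro eq_matI) (simp_all add: Circ_def)
qed

lemma HS_integral_Circ_iff:
  assumes "skew_symmetric n S" "n > 0"
  shows "HS_integral (Circ n S) \<longleftrightarrow> (\<forall>j. char_sum n (circ_weight n S) j \<in> \<int>)"
proof -
  have "eigenvalue (hermitian_adjacency2 (Circ n S)) x \<longleftrightarrow> (\<exists>j. x = char_sum n (circ_weight n S) j)" for x
    unfolding hermitian_adjacency2_Circ[OF assms]
    by (rule eigenvalue_circulant[OF assms(2)]) (rule circ_weight_cong)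
  thus ?thesis by (auto simp: HS_integral_def)
qed

section \<open>Connection sets of HS-integral graphs\<close>

lemma HS_integral_dilate:
  assumes "n \<ge> 2" "skew_symmetric n S" "HS_integral (Circ n S)"
    and "coprime a (int n)" "[a = 1] (mod 3)"
  shows "nat (a * k mod int n) \<in> S \<longleftrightarrow> nat (k mod int n) \<in> S"
proof -
  have "circ_weight n S (a * k) = circ_weight n S k"
    using assms HS_integral_Circ_iff[of n S]
    by (intro dilation_invariant[of n] circ_weight_cong circ_weight_vals) auto
  thus ?thesis by (metis circ_weight_eq_iff)
qed

text \<open>On the class of elements \<open>d u\<close> the multiplier \<open>a\<close> matters only modulo \<open>M = n / d\<close>, and a
  unit modulo \<open>M\<close> that is \<open>1\<close> modulo 3 lifts to a unit modulo \<open>n\<close> that is \<open>1\<close> modulo 3.\<close>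

lemma HS_integral_dilate_class:
  assumes n: "n \<ge> 2" and S: "skew_symmetric n S" "HS_integral (Circ n S)"
    and nM: "n = d * M"
    and a: "coprime a (int M)" "[a = 1] (mod 3)" "[a * u = u'] (mod int M)"
    and u: "nat (int d * u mod int n) \<in> S"
  shows "nat (int d * u' mod int n) \<in> S"
proof -
  have "coprime a 3" using a(2) by (meson cong_imp_coprime cong_sym coprime_1_left)
  hence "coprime a (int (3 * M))" using a(1) by simp
  moreover have "3 * M > 0" using n nM by (cases M) auto
  ultimately obtain m where m: "[int m = a] (mod int (3 * M))" "coprime m n"
    using ex_cong_coprime[of "3 * M" n a] n by auto
  have m3: "[int m = 1] (mod 3)"
    by (rule cong_trans[OF cong_dvd_modulus[OF m(1)] a(2)]) simp
  have "[int m = a] (mod int M)" by (rule cong_dvd_modulus[OF m(1)]) simp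
  hence "[int m * u = a * u] (mod int M)" by (rule cong_scalar_right)
  hence "[int m * u = u'] (mod int M)" using a(3) by (rule cong_trans)
  hence "[int d * (int m * u) = int d * u'] (mod int n)"
    by (auto simp: nM cong_iff_dvd_diff right_diff_distrib[symmetric])
  hence "int m * (int d * u) mod int n = int d * u' mod int n"
    by (simp add: cong_def mult.left_commute)
  thus ?thesis using HS_integral_dilate[OF n S, of "int m" "int d * u"] m(2) m3 u by simp
qed

text \<open>If 3 did not divide \<open>M = n / gcd(k, n)\<close>, some \<open>a\<close> would be \<open>1\<close> modulo 3 and \<open>-1\<close>
  modulo \<open>M\<close>; dilation by \<open>a\<close> sends \<open>k\<close> to \<open>-k\<close>, contradicting skew-symmetry.\<close>

lemma HS_integral_three_dvd:
  assumes n: "n \<ge> 2" and S: "skew_symmetric n S" "HS_integral (Circ n S)" and k: "k \<in> S"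
  shows "gcd k n dvd n div 3" "3 dvd n div gcd k n" "3 dvd n"
proof -
  define d where "d = gcd k n"
  obtain u where u: "k = d * u" unfolding d_def by (meson dvdE gcd_dvd1)
  obtain M where M: "n = d * M" unfolding d_def by (meson dvdE gcd_dvd2)
  have "d > 0" using n M by (cases d) auto
  have kn: "k < n" using k S(1) by (auto simp: skew_symmetric_def)
  have "3 dvd M"
  proof (rule ccontr)
    assume "\<not> 3 dvd M"
    hence "coprime 3 M" by (intro prime_imp_coprime) simp_all
    hence "coprime (int M) (int 3)" by (simp only: coprime_int_iff coprime_commute)
    hence "coprime (int M) 3" by simp
    then obtain a where a: "[a = - 1] (mod int M)" "[a = 1] (mod 3)"
      using binary_chinese_remainder_int by blast
    have "coprime a (int M)" using a(1) by (meson cong_imp_coprime cong_sym coprime_1_left coprime_minus_left_iff)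
    moreover have "[a * int u = - int u] (mod int M)"
      using cong_scalar_right[OF a(1), of "int u"] by simp
    moreover have "nat (int d * int u mod int n) \<in> S" using k kn by (simp flip: of_nat_mult u)
    ultimately have "nat (int d * - int u mod int n) \<in> S"
      using a(2) HS_integral_dilate_class[OF n S M] by blast
    moreover have "nat (- (int d * int u) mod int n) \<notin> S"
      using n k kn by (intro skew_symmetric_uminus[OF S(1)]) (simp_all flip: of_nat_mult u)
    ultimately show False by simp
  qed
  then obtain t where "M = 3 * t" by (elim dvdE)
  thus "gcd k n dvd n div 3" "3 dvd n div gcd k n" "3 dvd n"
    using M \<open>d > 0\<close> unfolding d_def[symmetric] by auto
qed

text \<open>The multiplier \<open>u' / u\<close> modulo \<open>M\<close> carries \<open>d u\<close> to \<open>d u'\<close>. It is \<open>1\<close> modulo 3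
  because 3 divides \<open>M\<close>.\<close>

lemma HS_integral_same_residue:
  assumes n: "n \<ge> 2" and S: "skew_symmetric n S" "HS_integral (Circ n S)"
    and M: "n = d * M" "3 dvd M" and u: "coprime u (int M)" "coprime u' (int M)" "[u = u'] (mod 3)"
    and uS: "nat (int d * u mod int n) \<in> S"
  shows "nat (int d * u' mod int n) \<in> S"
proof -
  obtain v where v: "[u * v = 1] (mod int M)"
    using cong_solve_coprime_int[OF u(1)] by blast
  have M3: "(3 :: int) dvd int M" using M(2) by presburger
  have "[u' * v = u * v] (mod 3)" using u(3) by (intro cong_scalar_right) (rule cong_sym)
  hence a3: "[u' * v = 1] (mod 3)" using cong_dvd_modulus[OF v M3] by (rule cong_trans)
  have "coprime (u * v) (int M)" using v by (meson cong_imp_coprime cong_sym coprime_1_left)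
  hence cop: "coprime (u' * v) (int M)" using u(2) by simp
  have "[u' * (u * v) = u' * 1] (mod int M)" using v by (rule cong_scalar_left)
  hence "[u' * v * u = u'] (mod int M)" by (simp add: mult_ac)
  thus ?thesis using HS_integral_dilate_class[OF n S M(1) cop a3 _ uS] by blast
qed

text \<open>The residue modulo 3 of \<open>k / d\<close> decides membership within a gcd class: the elements with the
  same residue lie in \<open>S\<close>, and those with the other residue do not, since their negatives do.\<close>

lemma HS_integral_gcd_class:
  assumes n: "n \<ge> 2" and S: "skew_symmetric n S" "HS_integral (Circ n S)" and k: "k \<in> S"
  shows "{x \<in> S. gcd x n = gcd k n} \<in> {G3 n 1 (gcd k n), G3 n 2 (gcd k n)}"
proof -
  define d where "d = gcd k n"
  obtain M where M: "n = d * M" unfolding d_def by (meson dvdE gcd_dvd2)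
  have d0: "d > 0" using n M by (cases d) auto
  have "3 dvd n div d" unfolding d_def by (rule HS_integral_three_dvd[OF n S k])
  hence M3: "3 dvd M" using M d0 by simp
  have cop: "coprime u M" if "gcd (d * u) n = d" for u
    using that d0 unfolding M gcd_mult_distrib_nat[symmetric] by (simp add: coprime_iff_gcd_eq_1)
  obtain u where u: "k = d * u" unfolding d_def by (meson dvdE gcd_dvd1)
  have "gcd (d * u) n = d" unfolding u[symmetric] by (rule d_def[symmetric])
  hence copu: "coprime u M" by (rule cop)
  have "\<not> 3 dvd u" using coprime_common_divisor[OF copu _ M3] by auto
  hence u12: "u mod 3 = 1 \<or> u mod 3 = 2" by presburger
  have lt: "x < n" "x \<noteq> 0" if "x \<in> S" for x
  proof -
    have "S \<subseteq> {0..<n}" "0 \<notin> S" using S(1) by (simp_all add: skew_symmetric_def)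
    thus "x < n" using that by auto
    show "x \<noteq> 0" using \<open>0 \<notin> S\<close> that by metis
  qed
  have "int d * int u = int k" by (simp add: u)
  hence uS: "nat (int d * int u mod int n) \<in> S" using k lt(1)[OF k] by simp
  have "{x \<in> S. gcd x n = d} = G3 n (u mod 3) d"
  proof (intro equalityI subsetI)
    fix x assume "x \<in> {x \<in> S. gcd x n = d}"
    hence x: "x \<in> S" "gcd x n = d" by auto
    have "d dvd x" unfolding x(2)[symmetric] by simp
    then obtain w where w: "x = d * w" by (elim dvdE)
    have copw: "coprime w M" by (rule cop) (use x(2) w in simp)
    have "[w = u mod 3] (mod 3)"
    proof (rule ccontr)
      assume neq: "\<not> [w = u mod 3] (mod 3)"
      have "\<not> 3 dvd w" using coprime_common_divisor[OF copw _ M3] by auto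
      moreover have "w mod 3 \<noteq> u mod 3" using neq by (simp add: cong_def)
      ultimately have "3 dvd u + w" using \<open>\<not> 3 dvd u\<close> by presburger
      hence "int 3 dvd int (u + w)" by (simp only: int_dvd_int_iff)
      hence "[int u = - int w] (mod 3)" by (simp add: cong_iff_dvd_diff)
      with uS have "nat (int d * - int w mod int n) \<in> S"
        using copu copw HS_integral_same_residue[OF n S M M3, of "int u" "- int w"] by simp
      moreover have "int d * int w = int x" by (simp add: w)
      hence "nat (- (int d * int w) mod int n) \<notin> S"
        using n x(1) lt(1)[OF x(1)] by (intro skew_symmetric_uminus[OF S(1)]) simp_all
      ultimately show False by simp
    qed
    moreover have "1 \<le> x" "x \<le> n - 1" using lt[OF x(1)] by linarith+
    ultimately show "x \<in> G3 n (u mod 3) d"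
      unfolding G3_def using x(2) unfolding w by blast
  next
    fix x assume "x \<in> G3 n (u mod 3) d"
    then obtain w where w: "x = d * w" "1 \<le> x" "x \<le> n - 1" "gcd x n = d" "[w = u mod 3] (mod 3)"
      by (auto simp: G3_def)
    have "coprime w M" by (rule cop) (use w(1,4) in simp)
    moreover have "[int u = int w] (mod 3)"
      using w(5) cong_int_iff[of u w 3] by (simp add: cong_def)
    moreover note uS
    ultimately have "nat (int d * int w mod int n) \<in> S"
      using copu HS_integral_same_residue[OF n S M M3, of "int u" "int w"] by simp
    moreover have "x < n" using w(2,3) by linarith
    moreover have "int d * int w = int x" by (simp add: w(1))
    ultimately have "x \<in> S" by simp
    thus "x \<in> {x \<in> S. gcd x n = d}" using w(4) by simp
  qed
  thus ?thesis unfolding d_def[symmetric] using u12 by (elim disjE) simp_all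
qed

section \<open>Ramanujan sums and the converse\<close>

lemma sum_unity_root_multiples_Ints:
  assumes n: "n > 0" and d: "d > 0" "d dvd int n"
  shows "(\<Sum>k\<in>{k \<in> {0..<int n}. d dvd k}. unity_root n (x * k)) \<in> \<int>"
proof -
  obtain M where M: "int n = d * M" using d(2) by (elim dvdE)
  have "M > 0" using n d(1) M by (metis of_nat_0_less_iff zero_less_mult_pos)
  have "int n = int (nat M * nat d)" using M d(1) \<open>M > 0\<close> by simp
  hence nM: "n = nat M * nat d" by (simp only: of_nat_eq_iff)
  have "(\<Sum>k\<in>{k \<in> {0..<int n}. d dvd k}. unity_root n (x * k))
      = (\<Sum>i\<in>{0..<M}. unity_root n (x * (d * i)))"
    by (rule sum.reindex_bij_witness[of _ "\<lambda>i. d * i" "\<lambda>k. k div d"])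
      (use d(1) M in \<open>auto simp: zero_le_mult_iff pos_imp_zdiv_nonneg_iff elim!: dvdE\<close>)
  also have "\<dots> = (\<Sum>i\<in>{0..<int (nat M)}. unity_root (nat M) (x * i))"
  proof (rule sum.cong)
    fix i
    have "unity_root n (x * (d * i)) = unity_root (nat M * nat d) (x * i * int (nat d))"
      using d(1) nM by (simp add: mult_ac)
    also have "\<dots> = unity_root (nat M) (x * i)"
      using d(1) by (intro unity_root_mult_cancel) simp
    finally show "unity_root n (x * (d * i)) = unity_root (nat M) (x * i)" .
  qed (use \<open>M > 0\<close> in simp)
  also have "\<dots> \<in> \<int>" using sum_unity_root[of "nat M" x] \<open>M > 0\<close> by simp
  finally show ?thesis .
qed

text \<open>The multiples of \<open>d\<close> split into the gcd classes of \<open>d\<close> and of its proper multiples. The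
  sum over all multiples is a full character sum, hence an integer, and descending induction on
  \<open>d\<close> handles the proper multiples.\<close>

lemma ramanujan_sum_Ints:
  assumes n: "n > 0" and d: "d > 0" "d dvd int n"
  shows "(\<Sum>k\<in>{k \<in> {0..<int n}. gcd k (int n) = d}. unity_root n (x * k)) \<in> \<int>"
  using d
proof (induction "nat (int n - d)" arbitrary: d rule: less_induct)
  case less
  let ?R = "{0..<int n}" and ?f = "\<lambda>k. unity_root n (x * k)" and ?g = "\<lambda>k. gcd k (int n)"
  let ?A = "{k \<in> ?R. ?g k = d}" and ?B = "{k \<in> ?R. d dvd k \<and> ?g k \<noteq> d}"
  have fin: "finite {k \<in> ?R. P k}" for P by (rule finite_subset[of _ ?R]) auto
  have split: "{k \<in> ?R. d dvd k} = ?A \<union> ?B" by auto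
  have "sum ?f {k \<in> ?R. d dvd k} = sum ?f ?A + sum ?f ?B"
    unfolding split by (rule sum.union_disjoint[OF fin fin]) auto
  hence A: "sum ?f ?A = sum ?f {k \<in> ?R. d dvd k} - sum ?f ?B" by simp
  have "sum ?f ?B = (\<Sum>e\<in>?g ` ?B. sum ?f {k \<in> ?B. ?g k = e})"
    by (rule sum.image_gen[OF fin])
  also have "\<dots> \<in> \<int>"
  proof (rule Ints_sum)
    fix e assume "e \<in> ?g ` ?B"
    then obtain k where k: "k \<in> ?R" "d dvd k" "?g k \<noteq> d" "e = ?g k" by blast
    have de: "d dvd e" using k(2,4) less.prems(2) by simp
    have e: "e > 0" "e dvd int n" using k(4) n by auto
    have "d < e" using zdvd_imp_le[OF de e(1)] k(3,4) by simp
    moreover have "e \<le> int n" using zdvd_imp_le[OF e(2)] n by simp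
    ultimately have "nat (int n - e) < nat (int n - d)" by simp
    hence "sum ?f {k \<in> ?R. ?g k = e} \<in> \<int>" using e by (rule less.hyps)
    moreover have "{k \<in> ?B. ?g k = e} = {k \<in> ?R. ?g k = e}"
      using de \<open>d < e\<close> by auto
    ultimately show "sum ?f {k \<in> ?B. ?g k = e} \<in> \<int>" by simp
  qed
  finally show ?case
    unfolding A using sum_unity_root_multiples_Ints[OF n less.prems] by (intro Ints_diff)
qed

lemma G3_iff:
  assumes "k < n" "0 < r" "r < 3" "d > 0"
  shows "k \<in> G3 n r d \<longleftrightarrow> gcd k n = d \<and> [k div d = r] (mod 3)"
proof
  assume "k \<in> G3 n r d"
  then obtain w where "k = d * w" "gcd (d * w) n = d" "[w = r] (mod 3)" unfolding G3_def by blast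
  thus "gcd k n = d \<and> [k div d = r] (mod 3)" using assms(4) by simp
next
  assume *: "gcd k n = d \<and> [k div d = r] (mod 3)"
  hence "d dvd k" by (metis gcd_dvd1)
  then obtain w where w: "k = d * w" by (elim dvdE)
  have r: "[w = r] (mod 3)" using * w assms(4) by simp
  have "w \<noteq> 0"
  proof
    assume "w = 0"
    with r assms(2,3) show False by (simp add: cong_def)
  qed
  hence "1 \<le> d * w" using assms(4) by simp
  moreover have "d * w \<le> n - 1" using w assms(1) by simp
  ultimately show "k \<in> G3 n r d" unfolding G3_def using w r * by blast
qed

lemma union_G3_iff:
  assumes n: "n > 0" "3 dvd n"
    and D: "\<And>d. d \<in> D \<Longrightarrow> d dvd n div 3"
    and r: "\<And>d. d \<in> D \<Longrightarrow> r d \<in> {1, 2}"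
    and d: "gcd k (int n) = int d"
  shows "nat (k mod int n) \<in> (\<Union>d\<in>D. G3 n (r d) d) \<longleftrightarrow> d \<in> D \<and> [k div int d = int (r d)] (mod 3)"
proof -
  define m where "m = nat (k mod int n)"
  have m: "int m = k mod int n" "m < n" using n by (auto simp: m_def nat_less_iff)
  have "gcd (int m) (int n) = int d"
    unfolding m(1) by (metis d gcd_red_int gcd.commute)
  hence gm: "gcd m n = d" by (metis gcd_int_int_eq of_nat_eq_iff)
  have "n div 3 > 0" using n by (auto elim!: dvdE)
  hence D0: "e > 0" if "e \<in> D" for e using D[OF that] by (rule dvd_pos_nat)
  have mem: "m \<in> G3 n (r e) e \<longleftrightarrow> e = d \<and> [m div e = r e] (mod 3)" if "e \<in> D" for e
    using G3_iff[OF m(2), of "r e" e] r[OF that] D0[OF that] gm by auto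
  have "[int m div int d = k div int d] (mod 3)" if "d \<in> D"
  proof -
    obtain t' where t': "n div 3 = d * t'" using D[OF \<open>d \<in> D\<close>] by (elim dvdE)
    have "n = 3 * (n div 3)" using n(2) by simp
    hence "int n = int (3 * (d * t'))" unfolding t' by (rule arg_cong)
    then obtain t where t: "int n = 3 * int d * t" by (intro that[of "int t'"]) simp
    have "k = k mod int n + int d * (3 * t * (k div int n))"
      using mult_div_mod_eq[of "int n" k] by (simp add: t mult_ac)
    hence "k div int d = (int m + int d * (3 * t * (k div int n))) div int d" by (simp only: m(1))
    also have "\<dots> = 3 * t * (k div int n) + int m div int d" using D0[OF that] by (subst div_mult_self2) auto
    finally show ?thesis by (simp add: cong_iff_dvd_diff)
  qed
  moreover have "[m div d = r d] (mod 3) \<longleftrightarrow> [int m div int d = int (r d)] (mod 3)"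
    using cong_int_iff[of "m div d" "r d" 3] by (simp add: of_nat_div)
  ultimately have "[m div d = r d] (mod 3) \<longleftrightarrow> [k div int d = int (r d)] (mod 3)" if "d \<in> D"
    using that by (meson cong_sym cong_trans)
  thus ?thesis unfolding m_def[symmetric] using mem by blast
qed

text \<open>The point of the definition of the second kind: since \<open>(1 + \<i> \<surd>3) / 2 = - \<omega>\<^bsup>-1\<^esup>\<close> for
  \<open>\<omega> = exp (2 \<pi> \<i> / 3)\<close>, the connection function is, on each gcd class that meets \<open>S\<close>, the
  negative of the character \<open>k \<mapsto> \<omega>\<^bsup>- r k / d\<^esup>\<close>. The same formula covers both choices of \<open>r\<close>
  because \<open>r\<^sup>2 \<equiv> 1 (mod 3)\<close>.\<close>

lemma circ_weight_union_G3:
  assumes n: "n > 0" "3 dvd n"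
    and D: "\<And>d. d \<in> D \<Longrightarrow> d dvd n div 3"
    and r: "\<And>d. d \<in> D \<Longrightarrow> r d \<in> {1, 2}"
    and d: "gcd k (int n) = int d"
  shows "circ_weight n (\<Union>d\<in>D. G3 n (r d) d) k =
    (if d \<in> D then - unity_root n (- (int (r d * (n div (3 * d))) * k)) else 0)"
proof -
  let ?S = "\<Union>d\<in>D. G3 n (r d) d"
  have iff: "nat (k mod int n) \<in> ?S \<longleftrightarrow> d \<in> D \<and> [k div int d = int (r d)] (mod 3)"
    by (rule union_G3_iff[OF n D r d])
  have "gcd (- k) (int n) = int d" using d by simp
  hence iff': "nat (- k mod int n) \<in> ?S \<longleftrightarrow> d \<in> D \<and> [- k div int d = int (r d)] (mod 3)"
    by (intro union_G3_iff[OF n D r])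
  show ?thesis
  proof (cases "d \<in> D")
    case False
    thus ?thesis using iff iff' by (simp add: circ_weight_def)
  next
    case True
    obtain t where "n div 3 = d * t" using D[OF True] by (elim dvdE)
    moreover have "n = 3 * (n div 3)" using n(2) by simp
    ultimately have t: "n = 3 * d * t" by (metis mult.assoc)
    hence pos: "d > 0" "t > 0" using n(1) by auto
    have "int d dvd k" unfolding d[symmetric] by simp
    then obtain u where u: "k = int d * u" by (elim dvdE)
    have "int n = int d * int (3 * t)" by (simp add: t)
    hence "gcd (int d * u) (int d * int (3 * t)) = int d" using d u by (simp only:)
    hence "int d * gcd u (int (3 * t)) = int d * 1" by (simp only: gcd_mult_distrib_int[symmetric] abs_of_nat mult_1_right)
    hence "coprime u (int (3 * t))" using pos by (simp add: coprime_iff_gcd_eq_1)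
    hence "coprime u 3" by simp
    hence "\<not> 3 dvd u" using coprime_common_divisor[OF \<open>coprime u 3\<close>, of 3] by auto
    have root: "unity_root n (- (int (r d * (n div (3 * d))) * k)) = unity_root 3 (- (int (r d) * u))"
      using unity_root_mult_cancel[of "d * t" 3 "- (int (r d) * u)"] pos
      by (simp add: u t mult_ac)
    \<comment> \<open>As a sixth root of unity the negated character value is compared through a congruence modulo 6.\<close>
    have neg: "- unity_root 3 y = unity_root 6 (2 * y + 3)" for y
    proof -
      have "unity_root 6 (2 * y) = unity_root 3 y" using unity_root_mult_cancel[of 2 3 y] by (simp add: mult_ac)
      moreover have "unity_root 6 3 = - 1" by (simp add: unity_root_def)
      ultimately show ?thesis by (simp add: unity_root_add)
    qed
    have six: "- unity_root 3 (- (int (r d) * u)) = unity_root 6 e" if "[3 - 2 * int (r d) * u = e] (mod 6)" for e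
      unfolding neg by (rule unity_root_cong) (use that in \<open>simp_all add: algebra_simps\<close>)
    have "- k = int d * - u" by (simp add: u)
    hence "- k div int d = - u" using pos by (simp only: nonzero_mult_div_cancel_left of_nat_eq_0_iff)
    moreover have "k div int d = u" using pos u by simp
    ultimately have div: "k div int d = u" "- k div int d = - u" by simp_all
    have r12: "r d = 1 \<or> r d = 2" using r[OF True] by simp
    show ?thesis
    proof (cases "[u = int (r d)] (mod 3)")
      case True': True
      have "[3 - 2 * int (r d) * u = 1] (mod 6)"
        using r12 True' by (elim disjE) (simp_all add: cong_def, presburger+)
      from six[OF this] show ?thesis
        using iff True True' root div by (simp add: circ_weight_def)
    next
      case False
      hence F: "[- u = int (r d)] (mod 3)"
        using r12 \<open>\<not> 3 dvd u\<close> False by (elim disjE) (simp_all add: cong_def, presburger+)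
      hence "[3 - 2 * int (r d) * u = - 1] (mod 6)"
        using r12 by (elim disjE) (simp_all add: cong_def, presburger+)
      from six[OF this] show ?thesis
        using iff iff' True False F root div by (simp add: circ_weight_def)
    qed
  qed
qed

text \<open>On each gcd class the character hidden in the connection function merely shifts the index
  \<open>j\<close>, so the Fourier coefficients are sums of negated Ramanujan sums.\<close>

lemma char_sum_union_G3_Ints:
  assumes n: "n > 0" "3 dvd n"
    and D: "\<And>d. d \<in> D \<Longrightarrow> d dvd n div 3"
    and r: "\<And>d. d \<in> D \<Longrightarrow> r d \<in> {1, 2}"
  shows "char_sum n (circ_weight n (\<Union>d\<in>D. G3 n (r d) d)) j \<in> \<int>"
proof -
  let ?R = "{0..<int n}" and ?g = "\<lambda>k. gcd k (int n)"
  let ?f = "\<lambda>k. circ_weight n (\<Union>d\<in>D. G3 n (r d) d) k * unity_root n (j * k)"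
  have "sum ?f ?R = (\<Sum>d\<in>?g ` ?R. sum ?f {k \<in> ?R. ?g k = d})"
    by (rule sum.image_gen) simp
  also have "\<dots> \<in> \<int>"
  proof (rule Ints_sum)
    fix d assume "d \<in> ?g ` ?R"
    hence d: "d > 0" "d dvd int n" using n by auto
    define m where "m = nat d"
    have dm: "d = int m" using d by (simp add: m_def)
    show "sum ?f {k \<in> ?R. ?g k = d} \<in> \<int>"
    proof (cases "m \<in> D")
      case False
      hence "sum ?f {k \<in> ?R. ?g k = d} = 0"
        using circ_weight_union_G3[where D = D and r = r and d = m and n = n] n D r dm
        by (intro sum.neutral) auto
      thus ?thesis by simp
    next
      case True
      let ?c = "int (r m * (n div (3 * m)))"
      have "?f k = - unity_root n ((j - ?c) * k)" if "?g k = d" for k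
      proof -
        have "- (?c * k) + j * k = (j - ?c) * k" by (simp add: algebra_simps)
        moreover have "circ_weight n (\<Union>d\<in>D. G3 n (r d) d) k = - unity_root n (- (?c * k))"
          using circ_weight_union_G3[OF n D r, where k = k and d = m] that dm True by simp
        ultimately show ?thesis by (simp only: mult_minus_left unity_root_add[symmetric])
      qed
      hence "sum ?f {k \<in> ?R. ?g k = d} = - (\<Sum>k\<in>{k \<in> ?R. ?g k = d}. unity_root n ((j - ?c) * k))"
        by (simp add: sum_negf)
      thus ?thesis using ramanujan_sum_Ints[OF n(1) d] by simp
    qed
  qed
  finally show ?thesis by (simp add: char_sum_def)
qed

section \<open>Characterisation of HS-integrality\<close>

theorem theorem4p2:
  fixes n :: nat and S :: "nat set"
  assumes "n \<ge> 2"
    and "skew_symmetric n S"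
  shows "HS_integral (Circ n S) \<longleftrightarrow>
    (if [n = 0] (mod 3)
     then \<exists>D Sn. D \<subseteq> {d. d dvd n div 3} \<and>
            (\<forall>d\<in>D. Sn d \<in> {G3 n 1 d, G3 n 2 d}) \<and>
            S = (\<Union>d\<in>D. Sn d)
     else S = {})"
    (is "_ \<longleftrightarrow> (if _ then ?union else _)")
proof -
  have n: "n > 0" using assms(1) by simp
  have iff: "HS_integral (Circ n S) \<longleftrightarrow> (\<forall>j. char_sum n (circ_weight n S) j \<in> \<int>)"
    by (rule HS_integral_Circ_iff[OF assms(2) n])
  show ?thesis
  proof (cases "3 dvd n")
    case True
    have "HS_integral (Circ n S) \<longleftrightarrow> ?union"
    proof
      assume HS: "HS_integral (Circ n S)"
      let ?D = "(\<lambda>k. gcd k n) ` S" and ?Sn = "\<lambda>d. {x \<in> S. gcd x n = d}"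
      have "?D \<subseteq> {d. d dvd n div 3}"
        using HS_integral_three_dvd(1)[OF assms HS] by blast
      moreover have "\<forall>d\<in>?D. ?Sn d \<in> {G3 n 1 d, G3 n 2 d}"
        using HS_integral_gcd_class[OF assms HS] by blast
      moreover have "S = (\<Union>d\<in>?D. ?Sn d)" by blast
      ultimately show ?union by (intro exI conjI)
    next
      assume ?union
      then obtain D Sn where D: "D \<subseteq> {d. d dvd n div 3}"
        and Sn: "\<forall>d\<in>D. Sn d \<in> {G3 n 1 d, G3 n 2 d}" and S: "S = (\<Union>d\<in>D. Sn d)"
        by blast
      define r where "r d = (if Sn d = G3 n 1 d then 1 else 2 :: nat)" for d
      have "Sn d = G3 n (r d) d" if "d \<in> D" for d
        using Sn that by (auto simp: r_def)
      hence "S = (\<Union>d\<in>D. G3 n (r d) d)" unfolding S by (intro SUP_cong refl)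
      moreover have "char_sum n (circ_weight n (\<Union>d\<in>D. G3 n (r d) d)) j \<in> \<int>" for j
        by (rule char_sum_union_G3_Ints[OF n True]) (use D in \<open>auto simp: r_def\<close>)
      ultimately show "HS_integral (Circ n S)" unfolding iff by simp
    qed
    thus ?thesis using True by (simp add: cong_0_iff)
  next
    case False
    have "HS_integral (Circ n S) \<longleftrightarrow> S = {}"
    proof
      assume "HS_integral (Circ n S)"
      thus "S = {}" using HS_integral_three_dvd(3)[OF assms] False by blast
    next
      assume "S = {}"
      thus "HS_integral (Circ n S)" unfolding iff by (simp add: char_sum_def circ_weight_def)
    qed
    thus ?thesis using False by (simp add: cong_0_iff)
  qed
qed

end
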